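(* Let $X$ be a path-connected topological space, let $n\ge 1$, and let $Y$ be a subspace of $X^{n}$. Then $\mathrm{TC}_{n,X}(Y)\le \mathrm{TC}_n(X)$.
   Context: For continuous maps $f_1,\dots,f_m : A\to B$, the higher homotopic distance $\mathrm{D}(f_1,\dots,f_m)$ is the least positive integer $r$ such that $A$ has an open cover $\{A_1,\dots,A_r\}$ with $f_1|_{A_i}\simeq f_2|_{A_i}\simeq\cdots\simeq f_m|_{A_i}$ (as maps $A_i\to B$) for every $i$ (and $\infty$ if no such $r$ exists); for a single map ($m=1$) it is $1$. For $X$ path-connected, with projections $p_i : X^{n}\to X$ onto the $i$-th factor, the higher topological complexity is $\mathrm{TC}_n(X)=\mathrm{D}(p_1,\dots,p_n)$, and for a subspace $Y\subseteq X^{n}$ the relative higher topological complexity is $\mathrm{TC}_{n,X}(Y)=\mathrm{D}(p_1|_Y,\dots,p_n|_Y)$. *)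

theory Defs
  imports "HOL-Analysis.Analysis" "HOL-Library.Extended_Nat"
begin

text \<open>
  The open cover is indexed by \<open>{1..r}\<close>; members may be empty or repeated, which does not affect the
  least possible \<open>r\<close>. The infimum of the empty set of extended naturals is \<open>\<infinity>\<close>. The maps are
  \<open>f 1, \<dots>, f m\<close>, and the constant is meaningful for \<open>m \<ge> 1\<close> and continuous \<open>f j\<close>. The predicate
  \<open>homotopic_with (\<lambda>_. True)\<close> depends only on the values of its arguments on the underlying set
  of the domain space, so no explicit restriction of \<open>f j\<close> to \<open>U i\<close> is needed.
\<close>

definition homotopic_distance ::
    "'a topology \<Rightarrow> 'b topology \<Rightarrow> nat \<Rightarrow> (nat \<Rightarrow> 'a \<Rightarrow> 'b) \<Rightarrow> enat" where
  "homotopic_distance A B m f =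
     Inf {enat r | r. r \<ge> 1 \<and>
       (\<exists>U :: nat \<Rightarrow> 'a set.
          (\<forall>i\<in>{1..r}. openin A (U i)) \<and>
          (\<Union>i\<in>{1..r}. U i) = topspace A \<and>
          (\<forall>i\<in>{1..r}. \<forall>j\<in>{1..<m}.
             homotopic_with (\<lambda>_. True) (subtopology A (U i)) B (f j) (f (Suc j))))}"

lemma homotopic_distance_single: "homotopic_distance A B 1 f = 1"
proof (rule antisym)
  show "homotopic_distance A B 1 f \<le> 1"
    unfolding homotopic_distance_def
    by (rule Inf_lower) (auto simp: one_enat_def intro!: exI[of _ "1::nat"] exI[of _ "\<lambda>_. topspace A"])
  show "1 \<le> homotopic_distance A B 1 f"
    unfolding homotopic_distance_def
    by (rule Inf_greatest) (auto simp: one_enat_def)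
qed

text \<open>Points of \<open>X\<^sup>n\<close> are extensional functions on \<open>{1..n}\<close>.\<close>

abbreviation cartesian_power :: "'a topology \<Rightarrow> nat \<Rightarrow> (nat \<Rightarrow> 'a) topology" where
  "cartesian_power X n \<equiv> product_topology (\<lambda>_. X) {1..n}"

definition higher_TC :: "nat \<Rightarrow> 'a topology \<Rightarrow> enat" where
  "higher_TC n X = homotopic_distance (cartesian_power X n) X n (\<lambda>i x. x i)"

definition relative_higher_TC :: "nat \<Rightarrow> 'a topology \<Rightarrow> (nat \<Rightarrow> 'a) set \<Rightarrow> enat" where
  "relative_higher_TC n X Y =
     homotopic_distance (subtopology (cartesian_power X n) Y) X n (\<lambda>i x. x i)"

end

theory Submission
  imports Defs
begin

text \<open>Homotopies restrict to subspaces. Given an open cover of \<open>A\<close> on whose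
  members the maps are homotopic, its trace on \<open>Y\<close> is an open cover of the subspace of
  the same size, with the homotopies restricted. So every size admissible for \<open>A\<close> is
  admissible for the subspace, and \<open>homotopic_distance_subtopology_le\<close> follows for
  arbitrary maps; the theorem is the case of the projections of \<open>X^n\<close>.\<close>

lemma homotopic_distance_subtopology_le:
  "homotopic_distance (subtopology A Y) B m f \<le> homotopic_distance A B m f"
  unfolding homotopic_distance_def
\<comment> \<open>A larger set has a smaller infimum, so inclusion of the sets of admissible
  \<open>r\<close> suffices; this also covers the value \<open>\<infinity>\<close>, the infimum of
  the empty set.\<close>
proof (rule Inf_superset_mono, safe)
  fix r :: nat and U :: "nat \<Rightarrow> 'a set"
  assume r: "r \<ge> 1"
    and U_open: "\<forall>i\<in>{1..r}. openin A (U i)"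
    and U_cover: "(\<Union>i\<in>{1..r}. U i) = topspace A"
    and homotopic: "\<forall>i\<in>{1..r}. \<forall>j\<in>{1..<m}.
      homotopic_with (\<lambda>_. True) (subtopology A (U i)) B (f j) (f (Suc j))"
  have "homotopic_with (\<lambda>_. True) (subtopology (subtopology A Y) (U i \<inter> Y)) B (f j) (f (Suc j))"
    if "i \<in> {1..r}" "j \<in> {1..<m}" for i j
  proof -
    have "homotopic_with (\<lambda>_. True) (subtopology (subtopology A (U i)) Y) B (f j) (f (Suc j))"
      using homotopic that by (simp add: homotopic_from_subtopology)
    \<comment> \<open>Both sides are \<open>A\<close> restricted to \<open>U i \<inter> Y\<close>:
      on the left as part of \<open>U i\<close>, where the homotopy lives, on the right as a member
      of the cover of \<open>Y\<close>.\<close>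
    moreover have "subtopology (subtopology A (U i)) Y = subtopology (subtopology A Y) (U i \<inter> Y)"
      by (simp add: subtopology_subtopology Int_ac)
    ultimately show ?thesis
      by simp
  qed
  moreover have "\<forall>i\<in>{1..r}. openin (subtopology A Y) (U i \<inter> Y)"
    using U_open by (auto simp: openin_subtopology)
  moreover have "(\<Union>i\<in>{1..r}. U i \<inter> Y) = topspace (subtopology A Y)"
    using U_cover by auto
  ultimately show "\<exists>s. enat r = enat s \<and> s \<ge> 1 \<and>
      (\<exists>V. (\<forall>i\<in>{1..s}. openin (subtopology A Y) (V i)) \<and>
        (\<Union>i\<in>{1..s}. V i) = topspace (subtopology A Y) \<and>
        (\<forall>i\<in>{1..s}. \<forall>j\<in>{1..<m}.
          homotopic_with (\<lambda>_. True) (subtopology (subtopology A Y) (V i)) B (f j) (f (Suc j))))"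
    using r by (intro exI[of _ r] conjI refl exI[of _ "\<lambda>i. U i \<inter> Y"] ballI) blast+
qed

theorem proposition3p3:
  fixes X :: "'a topology" and n :: nat and Y :: "(nat \<Rightarrow> 'a) set"
  assumes "path_connected_space X"
    and "n \<ge> 1"
    and "Y \<subseteq> topspace (cartesian_power X n)"
  shows "relative_higher_TC n X Y \<le> higher_TC n X"
  unfolding relative_higher_TC_def higher_TC_def
  \<comment> \<open>Both sides use the same family \<open>\<lambda>i x. x i\<close>; only the domain
    shrinks.\<close>
  by (rule homotopic_distance_subtopology_le)

end
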